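(* The quotient semigroup $\mathscr{PO}_\infty^{+}(\mathbb{N}^2_\leqslant)/\sigma$ is isomorphic to the free commutative monoid $\mathfrak{AM}_\omega$ over an infinite countable set.
   Context: $\mathbb{N}$ is the set of positive integers with its usual order, and $\mathbb{N}^2_\leqslant$ is $\mathbb{N}\times\mathbb{N}$ with the product order: $(i,m)\leqslant(j,n)$ iff $i\le j$ and $m\le n$. Partial maps are written on the right and composed left to right: $x(\alpha\beta)=(x\alpha)\beta$, with $\operatorname{dom}(\alpha\beta)=\{y\in\operatorname{dom}\alpha : y\alpha\in\operatorname{dom}\beta\}$. A partial map $\alpha\colon X\rightharpoonup X$ of a poset is monotone if $x\leqslant y$ implies $(x)\alpha\leqslant(y)\alpha$ for all $x,y\in\operatorname{dom}\alpha$. $\mathscr{PO}_\infty(\mathbb{N}^2_\leqslant)$ is the monoid, under composition, of all injective monotone partial selfmaps $\alpha$ of $\mathbb{N}^2_\leqslant$ such that $\operatorname{dom}\alpha$ and $\operatorname{ran}\alpha$ have finite complement in $\mathbb{N}\times\mathbb{N}$. Put $\mathsf{H}^1=\{(j,1): j\in\mathbb{N}\}$. Define $\mathscr{PO}_\infty^{+}(\mathbb{N}^2_\leqslant)=\{\alpha\in\mathscr{PO}_\infty(\mathbb{N}^2_\leqslant) : (\mathsf{H}^1\cap\operatorname{dom}\alpha)\alpha\subseteq\mathsf{H}^1\}$; this is a subsemigroup (known), and it contains all idempotents of $\mathscr{PO}_\infty(\mathbb{N}^2_\leqslant)$. $E(S)$ denotes the set of idempotents of a semigroup $S$. The relation $\sigma$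 on $\mathscr{PO}_\infty(\mathbb{N}^2_\leqslant)$ is defined by: $\alpha\sigma\beta$ iff there exists $\varepsilon\in E(\mathscr{PO}_\infty(\mathbb{N}^2_\leqslant))$ with $\alpha\varepsilon=\beta\varepsilon$. On $\mathscr{PO}_\infty^{+}(\mathbb{N}^2_\leqslant)$ the same symbol $\sigma$ denotes the induced (restricted) relation; it is a congruence. *)

theory Defs
  imports "HOL-Algebra.Group" "HOL-Library.Multiset" "HOL-Library.Product_Order"
    "HOL-Library.Countable_Set"
begin

text \<open>The positive quadrant \<open>\<nat> \<times> \<nat>\<close> with positive integers, as a subset of
  \<^typ>\<open>nat \<times> nat\<close>; \<open>\<le>\<close> on pairs is the componentwise order of Product_Order.\<close>

definition quadrant :: "(nat \<times> nat) set" where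
  "quadrant = {1..} \<times> {1..}"

definition H1 :: "(nat \<times> nat) set" where
  "H1 = {(j, 1) |j. 1 \<le> j}"

definition is_PO_inf :: "(nat \<times> nat \<rightharpoonup> nat \<times> nat) \<Rightarrow> bool" where
  "is_PO_inf \<alpha> \<longleftrightarrow>
     dom \<alpha> \<subseteq> quadrant \<and> ran \<alpha> \<subseteq> quadrant \<and>
     inj_on \<alpha> (dom \<alpha>) \<and>
     mono_on (dom \<alpha>) (the \<circ> \<alpha>) \<and>
     finite (quadrant - dom \<alpha>) \<and> finite (quadrant - ran \<alpha>)"

text \<open>Maps act on the right, so the product of \<open>\<alpha>\<close> and \<open>\<beta>\<close> is first \<open>\<alpha>\<close>, then \<open>\<beta>\<close>.\<close>

definition PO_inf :: "(nat \<times> nat \<rightharpoonup> nat \<times> nat) monoid" where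
  "PO_inf = \<lparr>carrier = {\<alpha>. is_PO_inf \<alpha>},
             monoid.mult = (\<lambda>\<alpha> \<beta>. \<beta> \<circ>\<^sub>m \<alpha>),
             one = Some |` quadrant\<rparr>"

definition PO_inf_plus :: "(nat \<times> nat \<rightharpoonup> nat \<times> nat) monoid" where
  "PO_inf_plus =
     PO_inf\<lparr>carrier := {\<alpha> \<in> carrier PO_inf. (the \<circ> \<alpha>) ` (H1 \<inter> dom \<alpha>) \<subseteq> H1}\<rparr>"

definition idempotents :: "('a, 'b) monoid_scheme \<Rightarrow> 'a set" where
  "idempotents G = {e \<in> carrier G. e \<otimes>\<^bsub>G\<^esub> e = e}"

definition sigma_rel :: "(nat \<times> nat \<rightharpoonup> nat \<times> nat) rel" where
  "sigma_rel = {(\<alpha>, \<beta>). \<alpha> \<in> carrier PO_inf \<and> \<beta> \<in> carrier PO_inf \<and>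
     (\<exists>\<epsilon> \<in> idempotents PO_inf. \<alpha> \<otimes>\<^bsub>PO_inf\<^esub> \<epsilon> = \<beta> \<otimes>\<^bsub>PO_inf\<^esub> \<epsilon>)}"

definition sigma_plus :: "(nat \<times> nat \<rightharpoonup> nat \<times> nat) rel" where
  "sigma_plus = sigma_rel \<inter> (carrier PO_inf_plus \<times> carrier PO_inf_plus)"

text \<open>For a congruence \<open>r\<close> all the sets in the union below coincide, so that the product of
  two classes is the class of the product of any representatives.\<close>

definition quotient_monoid :: "('a, 'b) monoid_scheme \<Rightarrow> 'a rel \<Rightarrow> 'a set monoid" where
  "quotient_monoid G r =
     \<lparr>carrier = carrier G // r,
      monoid.mult = (\<lambda>A B. \<Union>a\<in>A. \<Union>b\<in>B. r `` {a \<otimes>\<^bsub>G\<^esub> b}),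
      one = r `` {\<one>\<^bsub>G\<^esub>}\<rparr>"

text \<open>The free commutative monoid over \<open>X\<close>: finite multisets of elements of \<open>X\<close> under sum.\<close>

definition free_comm_monoid :: "'a set \<Rightarrow> 'a multiset monoid" where
  "free_comm_monoid X = \<lparr>carrier = {M. set_mset M \<subseteq> X}, monoid.mult = (+), one = {#}\<rparr>"

end

theory Submission imports Defs begin

text \<open>
  Two maps are \<open>\<sigma>\<close>-related iff they differ at finitely many points only
  (\<open>sigma_rel_iff\<close>), because an idempotent injection is the identity on its cofinite
  domain.  So the quotient consists of germs at infinity, and the task is to see which germs
  occur.

  Let \<open>\<alpha>\<close> be an element of \<open>PO_inf_plus\<close>.  Since it preserves the bottom
  row, it also preserves the leftmost column (\<open>column_preserving\<close>); hence reflecting the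
  quadrant in its diagonal is a symmetry of the whole situation, and everything said about rows
  holds for columns.  Far out in the \<open>n\<close>-th row the map is a translation to the left by
  some \<open>a\<^sub>n \<ge> 0\<close>.  By monotonicity a point is sent at least as
  far to the right as the point below it in the bottom row; if the bottom row were pushed to the
  right, the points of tall boxes would therefore not have enough candidates for preimages
  (\<open>row_shift_first_row\<close>).  The other rows are reached
  by deleting bottom rows one after another (\<open>peel_row_preserving\<close>).

  Monotonicity gives \<open>a\<^sub>1 \<ge> a\<^sub>2 \<ge> \<dots>\<close>, and as a box cannot receive from
  outside more points than it has missing domain points, \<open>a\<^sub>n = 0\<close> for large
  \<open>n\<close> (\<open>ex_row_shift_0\<close>).  Likewise the columns give a partition
  \<open>b\<^sub>1 \<ge> b\<^sub>2 \<ge> \<dots>\<close>.  Away from finitely many rows and columns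
  \<open>\<alpha>\<close> is the identity wherever it is defined (\<open>identity_near_infinity\<close>), so the two partitions
  determine the germ (\<open>finite_difference_iff\<close>).  Shifts add up under composition, and
  every pair of partitions occurs because the maps moving the first \<open>n\<close> rows one step
  to the left and their reflections generate all pairs (\<open>row_partition_surj\<close>).

  Partitions under pointwise addition are free commutative: the multiplicity of the generator
  \<open>n\<close> is the drop \<open>a\<^sub>n - a\<^sub>n\<^sub>+\<^sub>1\<close>.  The quotient is therefore the
  product of two free commutative monoids of countable rank, that is, the free commutative monoid
  on a disjoint union of two countably infinite sets.
\<close>

section \<open>Monotone injections with cofinite domain and range\<close>

lemma mem_quadrant: "(i, j) \<in> quadrant \<longleftrightarrow> 1 \<le> i \<and> 1 \<le> j"
  by (auto simp: quadrant_def)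

text \<open>The conditions on \<open>the \<circ> \<alpha>\<close> and \<open>dom \<alpha>\<close> in terms of
  the graph of \<open>\<alpha>\<close>, which is the form in which all arguments below use them.\<close>

lemma is_PO_inf_iff:
  "is_PO_inf \<alpha> \<longleftrightarrow>
     (\<forall>x y. \<alpha> x = Some y \<longrightarrow> x \<in> quadrant \<and> y \<in> quadrant) \<and>
     (\<forall>x x' y. \<alpha> x = Some y \<longrightarrow> \<alpha> x' = Some y \<longrightarrow> x = x') \<and>
     (\<forall>x x' y y'. \<alpha> x = Some y \<longrightarrow> \<alpha> x' = Some y' \<longrightarrow> x \<le> x' \<longrightarrow> y \<le> y') \<and>
     finite (quadrant - dom \<alpha>) \<and> finite (quadrant - ran \<alpha>)"
proof -
  have "dom \<alpha> \<subseteq> quadrant \<and> ran \<alpha> \<subseteq> quadrant \<longleftrightarrow>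
      (\<forall>x y. \<alpha> x = Some y \<longrightarrow> x \<in> quadrant \<and> y \<in> quadrant)"
    unfolding dom_def ran_def by blast
  moreover have "inj_on \<alpha> (dom \<alpha>) \<longleftrightarrow>
      (\<forall>x x' y. \<alpha> x = Some y \<longrightarrow> \<alpha> x' = Some y \<longrightarrow> x = x')"
    by (metis (mono_tags, lifting) domD domI inj_onD inj_onI)
  moreover have "mono_on (dom \<alpha>) (the \<circ> \<alpha>) \<longleftrightarrow>
      (\<forall>x x' y y'. \<alpha> x = Some y \<longrightarrow> \<alpha> x' = Some y' \<longrightarrow> x \<le> x' \<longrightarrow> y \<le> y')"
  proof (intro iffI allI impI)
    fix x x' y y'
    assume "mono_on (dom \<alpha>) (the \<circ> \<alpha>)" "\<alpha> x = Some y" "\<alpha> x' = Some y'" "x \<le> x'"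
    then show "y \<le> y'"
      using monotone_onD[of "dom \<alpha>" "(\<le>)" "(\<le>)" "the \<circ> \<alpha>" x x'] by (simp add: domI)
  next
    assume H: "\<forall>x x' y y'. \<alpha> x = Some y \<longrightarrow> \<alpha> x' = Some y' \<longrightarrow> x \<le> x' \<longrightarrow> y \<le> y'"
    show "mono_on (dom \<alpha>) (the \<circ> \<alpha>)"
    proof (rule monotone_onI)
      fix x x' assume x: "x \<in> dom \<alpha>" "x' \<in> dom \<alpha>" "x \<le> x'"
      then obtain y y' where "\<alpha> x = Some y" "\<alpha> x' = Some y'" by blast
      then show "(the \<circ> \<alpha>) x \<le> (the \<circ> \<alpha>) x'"
        using H x(3) by (metis comp_apply option.sel)
    qed
  qed
  ultimately show ?thesis
    unfolding is_PO_inf_def by argo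
qed

definition row_preserving :: "(nat \<times> nat \<rightharpoonup> nat \<times> nat) \<Rightarrow> bool" where
  "row_preserving \<alpha> \<longleftrightarrow> is_PO_inf \<alpha> \<and> (\<forall>i k l. \<alpha> (i, 1) = Some (k, l) \<longrightarrow> l = 1)"

lemma carrier_PO_inf_plus: "carrier PO_inf_plus = {\<alpha>. row_preserving \<alpha>}"
proof -
  have "(the \<circ> \<alpha>) ` (H1 \<inter> dom \<alpha>) \<subseteq> H1 \<longleftrightarrow> (\<forall>i k l. \<alpha> (i, 1) = Some (k, l) \<longrightarrow> l = 1)"
    if "is_PO_inf \<alpha>" for \<alpha>
  proof -
    have Q: "x \<in> quadrant \<and> y \<in> quadrant" if "\<alpha> x = Some y" for x y
      using \<open>is_PO_inf \<alpha>\<close> that unfolding is_PO_inf_iff by blast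
    show ?thesis
    proof (intro iffI allI impI)
      fix i k l assume H: "(the \<circ> \<alpha>) ` (H1 \<inter> dom \<alpha>) \<subseteq> H1" and a: "\<alpha> (i, 1) = Some (k, l)"
      have "(i, 1) \<in> H1 \<inter> dom \<alpha>"
        using Q[OF a] a by (auto simp: H1_def mem_quadrant)
      then have "(k, l) \<in> H1"
        using H a by (metis (no_types, lifting) comp_apply image_subset_iff option.sel)
      then show "l = 1" by (auto simp: H1_def)
    next
      assume H: "\<forall>i k l. \<alpha> (i, 1) = Some (k, l) \<longrightarrow> l = 1"
      show "(the \<circ> \<alpha>) ` (H1 \<inter> dom \<alpha>) \<subseteq> H1"
      proof (rule image_subsetI)
        fix p assume "p \<in> H1 \<inter> dom \<alpha>"
        then obtain i k l where p: "p = (i, 1)" and a: "\<alpha> (i, 1) = Some (k, l)"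
          by (force simp: H1_def)
        then have "l = 1" using H by blast
        then show "(the \<circ> \<alpha>) p \<in> H1"
          using Q[OF a] p a by (simp add: H1_def mem_quadrant)
      qed
    qed
  qed
  then show ?thesis
    unfolding PO_inf_plus_def PO_inf_def row_preserving_def by auto
qed

context
  fixes \<alpha> :: "nat \<times> nat \<rightharpoonup> nat \<times> nat"
  assumes \<alpha>: "is_PO_inf \<alpha>"
begin

lemma PO_inf_quadrant: "\<alpha> x = Some y \<Longrightarrow> x \<in> quadrant" "\<alpha> x = Some y \<Longrightarrow> y \<in> quadrant"
  using \<alpha> unfolding is_PO_inf_iff by blast+

lemma PO_inf_inj: "\<alpha> x = Some y \<Longrightarrow> \<alpha> x' = Some y \<Longrightarrow> x = x'"
  using \<alpha> unfolding is_PO_inf_iff by blast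

lemma PO_inf_mono_le: "\<alpha> x = Some y \<Longrightarrow> \<alpha> x' = Some y' \<Longrightarrow> x \<le> x' \<Longrightarrow> y \<le> y'"
  using \<alpha> unfolding is_PO_inf_iff by blast

lemma PO_inf_mono:
  "\<alpha> (i, j) = Some (k, l) \<Longrightarrow> \<alpha> (i', j') = Some (k', l') \<Longrightarrow> i \<le> i' \<Longrightarrow> j \<le> j' \<Longrightarrow>
    k \<le> k' \<and> l \<le> l'"
  using PO_inf_mono_le[of "(i, j)" "(k, l)" "(i', j')" "(k', l')"] by simp

lemma PO_inf_cofinite: "finite (quadrant - dom \<alpha>)" "finite (quadrant - ran \<alpha>)"
  using \<alpha> unfolding is_PO_inf_iff by blast+

end

lemma finite_PO_inf_preimage:
  assumes "is_PO_inf \<alpha>" "finite Y"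
  shows "finite {x. \<exists>y\<in>Y. \<alpha> x = Some y}"
proof (rule finite_imageD)
  show "finite ((the \<circ> \<alpha>) ` {x. \<exists>y\<in>Y. \<alpha> x = Some y})"
    by (rule finite_subset[OF _ assms(2)]) auto
  show "inj_on (the \<circ> \<alpha>) {x. \<exists>y\<in>Y. \<alpha> x = Some y}"
  proof (rule inj_onI)
    fix x x' assume "x \<in> {x. \<exists>y\<in>Y. \<alpha> x = Some y}" "x' \<in> {x. \<exists>y\<in>Y. \<alpha> x = Some y}"
      and eq: "(the \<circ> \<alpha>) x = (the \<circ> \<alpha>) x'"
    then obtain y y' where "\<alpha> x = Some y" "\<alpha> x' = Some y'" by blast
    then show "x = x'" using PO_inf_inj[OF assms(1), of x y x'] eq by simp
  qed
qed

lemma row_preserving_comp: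
  assumes "row_preserving \<alpha>" "row_preserving \<beta>"
  shows "row_preserving (\<beta> \<circ>\<^sub>m \<alpha>)"
proof -
  have \<alpha>: "is_PO_inf \<alpha>" and \<beta>: "is_PO_inf \<beta>"
    using assms by (simp_all add: row_preserving_def)
  have comp: "(\<beta> \<circ>\<^sub>m \<alpha>) x = Some z \<longleftrightarrow> (\<exists>y. \<alpha> x = Some y \<and> \<beta> y = Some z)" for x z
    by (auto simp: map_comp_Some_iff)
  have "quadrant - dom (\<beta> \<circ>\<^sub>m \<alpha>) \<subseteq>
      (quadrant - dom \<alpha>) \<union> {x. \<exists>y\<in>quadrant - dom \<beta>. \<alpha> x = Some y}"
  proof
    fix x assume x: "x \<in> quadrant - dom (\<beta> \<circ>\<^sub>m \<alpha>)"
    show "x \<in> (quadrant - dom \<alpha>) \<union> {x. \<exists>y\<in>quadrant - dom \<beta>. \<alpha> x = Some y}"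
    proof (cases "\<alpha> x")
      case (Some y)
      then have "y \<in> quadrant - dom \<beta>"
        using x PO_inf_quadrant(2)[OF \<alpha> Some] by (auto simp: map_comp_def)
      then show ?thesis using Some by blast
    qed (use x in auto)
  qed
  then have dom: "finite (quadrant - dom (\<beta> \<circ>\<^sub>m \<alpha>))"
    by (rule finite_subset)
      (intro finite_UnI PO_inf_cofinite[OF \<alpha>] PO_inf_cofinite[OF \<beta>] finite_PO_inf_preimage[OF \<alpha>])
  have "quadrant - ran (\<beta> \<circ>\<^sub>m \<alpha>) \<subseteq>
      (quadrant - ran \<beta>) \<union> (the \<circ> \<beta>) ` (quadrant - ran \<alpha>)"
  proof
    fix z assume z: "z \<in> quadrant - ran (\<beta> \<circ>\<^sub>m \<alpha>)"
    show "z \<in> (quadrant - ran \<beta>) \<union> (the \<circ> \<beta>) ` (quadrant - ran \<alpha>)"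
    proof (cases "z \<in> ran \<beta>")
      case True
      then obtain y where y: "\<beta> y = Some z" unfolding ran_def by blast
      have "y \<notin> ran \<alpha>"
      proof
        assume "y \<in> ran \<alpha>"
        then obtain x where "\<alpha> x = Some y" unfolding ran_def by blast
        then have "(\<beta> \<circ>\<^sub>m \<alpha>) x = Some z" using y comp by blast
        then show False using z unfolding ran_def by blast
      qed
      moreover have "y \<in> quadrant" "z = (the \<circ> \<beta>) y"
        using PO_inf_quadrant(1)[OF \<beta> y] y by simp_all
      ultimately show ?thesis by blast
    qed (use z in blast)
  qed
  then have ran: "finite (quadrant - ran (\<beta> \<circ>\<^sub>m \<alpha>))"
    by (rule finite_subset) (simp add: PO_inf_cofinite[OF \<alpha>] PO_inf_cofinite[OF \<beta>])
  have "is_PO_inf (\<beta> \<circ>\<^sub>m \<alpha>)"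
    unfolding is_PO_inf_iff
  proof (intro conjI allI impI)
    fix x z assume "(\<beta> \<circ>\<^sub>m \<alpha>) x = Some z"
    then show "x \<in> quadrant" "z \<in> quadrant"
      unfolding comp using PO_inf_quadrant[OF \<alpha>] PO_inf_quadrant[OF \<beta>] by blast+
  next
    fix x x' z assume "(\<beta> \<circ>\<^sub>m \<alpha>) x = Some z" "(\<beta> \<circ>\<^sub>m \<alpha>) x' = Some z"
    then show "x = x'"
      unfolding comp using PO_inf_inj[OF \<alpha>] PO_inf_inj[OF \<beta>] by metis
  next
    fix x x' z z'
    assume a: "(\<beta> \<circ>\<^sub>m \<alpha>) x = Some z" "(\<beta> \<circ>\<^sub>m \<alpha>) x' = Some z'" "x \<le> x'"
    then obtain y y' where y: "\<alpha> x = Some y" "\<beta> y = Some z" "\<alpha> x' = Some y'" "\<beta> y' = Some z'"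
      unfolding comp by blast
    show "z \<le> z'"
      by (rule PO_inf_mono_le[OF \<beta> y(2,4) PO_inf_mono_le[OF \<alpha> y(1,3) a(3)]])
  qed (fact dom ran)+
  moreover have "l = 1" if a: "(\<beta> \<circ>\<^sub>m \<alpha>) (i, 1) = Some (k, l)" for i k l
  proof -
    obtain y where y: "\<alpha> (i, 1) = Some y" "\<beta> y = Some (k, l)"
      using a unfolding comp by blast
    moreover obtain m n where "y = (m, n)" by (cases y)
    ultimately have mn: "\<alpha> (i, 1) = Some (m, n)" "\<beta> (m, n) = Some (k, l)" by simp_all
    then have "n = 1" using assms(1) unfolding row_preserving_def by blast
    then show ?thesis using mn(2) assms(2) unfolding row_preserving_def by blast
  qed
  ultimately show ?thesis by (simp add: row_preserving_def)
qed

lemma eventually_row_notin: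
  assumes "finite B"
  shows "\<forall>\<^sub>F i in sequentially. (i, n) \<notin> B"
proof -
  have "{i. (i, n) \<in> B} \<subseteq> fst ` B" by force
  then have "finite {i. (i, n) \<in> B}"
    using assms finite_subset by blast
  then show ?thesis
    by (simp add: eventually_cofinite flip: cofinite_eq_sequentially)
qed

lemma eventually_row_in:
  assumes "finite (quadrant - A)" "1 \<le> n"
  shows "\<forall>\<^sub>F i in sequentially. (i, n) \<in> A"
  using eventually_row_notin[OF assms(1), of n] eventually_ge_at_top[of 1]
  by eventually_elim (use assms(2) in \<open>auto simp: mem_quadrant\<close>)

section \<open>Reflection in the diagonal\<close>

definition transpose_map :: "(nat \<times> nat \<rightharpoonup> nat \<times> nat) \<Rightarrow> (nat \<times> nat \<rightharpoonup> nat \<times> nat)" where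
  "transpose_map \<alpha> p = map_option prod.swap (\<alpha> (prod.swap p))"

lemma transpose_map_Some [simp]:
  "transpose_map \<alpha> (i, j) = Some (k, l) \<longleftrightarrow> \<alpha> (j, i) = Some (l, k)"
  by (auto simp: transpose_map_def)

lemma transpose_map_eq_iff:
  "transpose_map \<alpha> (i, j) = transpose_map \<beta> (i, j) \<longleftrightarrow> \<alpha> (j, i) = \<beta> (j, i)"
  by (simp add: transpose_map_def inj_eq[OF option.inj_map[OF inj_swap]])

lemma transpose_map_transpose_map [simp]: "transpose_map (transpose_map \<alpha>) = \<alpha>"
  by (auto simp: transpose_map_def option.map_comp fun_eq_iff option.map_ident_strong)

lemma transpose_map_comp: "transpose_map (\<beta> \<circ>\<^sub>m \<alpha>) = transpose_map \<beta> \<circ>\<^sub>m transpose_map \<alpha>"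
  by (auto simp: transpose_map_def map_comp_def fun_eq_iff split: option.splits)

lemma transpose_map_PO_inf:
  assumes "is_PO_inf \<alpha>"
  shows "is_PO_inf (transpose_map \<alpha>)"
proof -
  have d: "quadrant - dom (transpose_map \<alpha>) = prod.swap ` (quadrant - dom \<alpha>)"
  proof -
    have "(i, j) \<in> dom (transpose_map \<alpha>) \<longleftrightarrow> (j, i) \<in> dom \<alpha>" for i j
      by (auto simp: transpose_map_def dom_def)
    then show ?thesis by (simp add: set_eq_iff mem_quadrant conj_commute)
  qed
  have r: "quadrant - ran (transpose_map \<alpha>) = prod.swap ` (quadrant - ran \<alpha>)"
  proof -
    have "(i, j) \<in> ran (transpose_map \<alpha>) \<longleftrightarrow> (j, i) \<in> ran \<alpha>" for i j
      by (auto simp: ran_def)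
    then show ?thesis by (simp add: set_eq_iff mem_quadrant conj_commute)
  qed
  show ?thesis
    unfolding is_PO_inf_iff d r
  proof (intro conjI allI impI)
    fix x y assume a: "transpose_map \<alpha> x = Some y"
    obtain i j k l where xy: "x = (i, j)" "y = (k, l)" by (metis surj_pair)
    then have "(j, i) \<in> quadrant" "(l, k) \<in> quadrant"
      using PO_inf_quadrant[OF assms, of "(j, i)" "(l, k)"] a by simp_all
    then show "x \<in> quadrant" "y \<in> quadrant"
      by (simp_all add: xy mem_quadrant)
  next
    fix x x' y assume "transpose_map \<alpha> x = Some y" "transpose_map \<alpha> x' = Some y"
    then show "x = x'"
      using PO_inf_inj[OF assms, of "prod.swap x" "prod.swap y" "prod.swap x'"]
      by (cases x; cases x'; cases y) simp
  next
    fix x x' y y'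
    assume "transpose_map \<alpha> x = Some y" "transpose_map \<alpha> x' = Some y'" "x \<le> x'"
    then show "y \<le> y'"
      using PO_inf_mono[OF assms, of "snd x" "fst x" "snd y" "fst y" "snd x'" "fst x'" "snd y'" "fst y'"]
      by (cases x; cases x'; cases y; cases y') simp
  qed (simp_all add: PO_inf_cofinite[OF assms])
qed

text \<open>The preimages of the infinitely many points of the leftmost column lie in finitely many
  columns: a preimage far to the right would dominate a point of the bottom row whose image is
  already outside the leftmost column.  So there are arbitrarily high preimages, each point of the
  leftmost column lies below one of them, and by monotonicity its image cannot leave the leftmost
  column.\<close>

lemma column_preserving:
  assumes "row_preserving \<alpha>" "\<alpha> (1, j) = Some (k, l)"
  shows "k = 1"
proof -
  have \<alpha>: "is_PO_inf \<alpha>" and row: "\<And>i k l. \<alpha> (i, 1) = Some (k, l) \<Longrightarrow> l = 1"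
    using assms unfolding row_preserving_def by blast+
  obtain N where N: "\<And>i. i \<ge> N \<Longrightarrow> (i, 1) \<in> dom \<alpha>"
    using eventually_row_in[OF PO_inf_cofinite(1)[OF \<alpha>], of 1]
    by (auto simp: eventually_sequentially)
  have "\<exists>a. \<alpha> (i, 1) = Some (a, 1)" if "i \<ge> N" for i
    using N[OF that] row[of i] by auto
  then obtain a b where ab: "\<alpha> (N, 1) = Some (a, 1)" "\<alpha> (Suc N, 1) = Some (b, 1)"
    by (meson le_refl le_SucI)
  have "a \<noteq> b" "a \<le> b" "1 \<le> a"
    using PO_inf_inj[OF \<alpha> ab(1), of "(Suc N, 1)"] ab(2) PO_inf_mono[OF \<alpha> ab]
      PO_inf_quadrant(2)[OF \<alpha> ab(1)]
    by (auto simp: mem_quadrant)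
  then have b: "1 < b" by simp
  define P where "P = {x. \<exists>l. \<alpha> x = Some (1, l)}"
  have low: "i \<le> N" if "(i, j) \<in> P" for i j
  proof (rule ccontr)
    assume "\<not> i \<le> N"
    obtain l where l: "\<alpha> (i, j) = Some (1, l)" using \<open>(i, j) \<in> P\<close> by (auto simp: P_def)
    then have "1 \<le> j" using PO_inf_quadrant[OF \<alpha> l] by (auto simp: mem_quadrant)
    then have "b \<le> 1" using PO_inf_mono[OF \<alpha> ab(2) l] \<open>\<not> i \<le> N\<close> by simp
    then show False using b by simp
  qed
  have inf: "infinite P"
  proof
    assume "finite P"
    have "{1} \<times> {1..} \<subseteq> (the \<circ> \<alpha>) ` P \<union> (quadrant - ran \<alpha>)"
    proof
      fix y :: "nat \<times> nat" assume "y \<in> {1} \<times> {1..}"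
      then obtain l where y: "y = (1, l)" "1 \<le> l" by auto
      show "y \<in> (the \<circ> \<alpha>) ` P \<union> (quadrant - ran \<alpha>)"
      proof (cases "y \<in> ran \<alpha>")
        case True
        then obtain x where "\<alpha> x = Some (1, l)" by (auto simp: y ran_def)
        then have "x \<in> P" "y = (the \<circ> \<alpha>) x" by (auto simp: P_def y)
        then show ?thesis by blast
      qed (use y in \<open>simp add: mem_quadrant\<close>)
    qed
    then have "finite ({1::nat} \<times> {1::nat..})"
      using \<open>finite P\<close> PO_inf_cofinite(2)[OF \<alpha>] by (meson finite_UnI finite_imageI finite_subset)
    then show False by (simp add: finite_cartesian_product_iff infinite_Ici)
  qed
  have "\<not> P \<subseteq> {..N} \<times> {..<j}"
    using inf finite_subset[of P "{..N} \<times> {..<j}"] by auto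
  then obtain i' j' where "(i', j') \<in> P" "j \<le> j'"
    using low by (meson SigmaI atMost_iff lessThan_iff not_less subrelI)
  then obtain l' where x: "j \<le> j'" "\<alpha> (i', j') = Some (1, l')"
    by (auto simp: P_def)
  moreover have "1 \<le> i'" using PO_inf_quadrant(1)[OF \<alpha> x(2)] by (simp add: mem_quadrant)
  ultimately have "k \<le> 1"
    using PO_inf_mono[OF \<alpha> assms(2) x(2)] by simp
  then show ?thesis
    using PO_inf_quadrant(2)[OF \<alpha> assms(2)] by (simp add: mem_quadrant)
qed

text \<open>From here on every statement about rows has a counterpart for columns.\<close>

lemma transpose_map_row_preserving:
  assumes "row_preserving \<alpha>"
  shows "row_preserving (transpose_map \<alpha>)"
proof -
  have "is_PO_inf (transpose_map \<alpha>)"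
    using assms transpose_map_PO_inf by (simp add: row_preserving_def)
  moreover have "l = 1" if "transpose_map \<alpha> (i, 1) = Some (k, l)" for i k l
    using column_preserving[OF assms, of i l k] that by simp
  ultimately show ?thesis
    by (simp add: row_preserving_def)
qed

section \<open>Every row is eventually translated to the left\<close>

text \<open>The translation is read off at the image \<open>(i, n)\<close>, so that no subtraction
  occurs and shifts compose by plain addition.\<close>

definition row_shift :: "(nat \<times> nat \<rightharpoonup> nat \<times> nat) \<Rightarrow> nat \<Rightarrow> nat \<Rightarrow> bool" where
  "row_shift \<alpha> n k \<longleftrightarrow> (\<forall>\<^sub>F i in sequentially. \<alpha> (i + k, n) = Some (i, n))"

lemma row_shift_unique:
  assumes "row_shift \<alpha> n k" "row_shift \<alpha> n l"
  shows "k = l"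
proof -
  obtain N where N: "\<And>i. i \<ge> N \<Longrightarrow> \<alpha> (i + k, n) = Some (i, n) \<and> \<alpha> (i + l, n) = Some (i, n)"
    using eventually_conj[OF assms[unfolded row_shift_def]] by (auto simp: eventually_sequentially)
  have "\<alpha> ((N + l) + k, n) = Some (N + l, n)" "\<alpha> ((N + k) + l, n) = Some (N + k, n)"
    using N by simp_all
  then show ?thesis by (simp add: ac_simps)
qed

lemma row_shift_comp:
  assumes "row_shift \<alpha> n k" "row_shift \<beta> n l"
  shows "row_shift (\<beta> \<circ>\<^sub>m \<alpha>) n (k + l)"
proof -
  have "\<forall>\<^sub>F i in sequentially. \<alpha> (i + l + k, n) = Some (i + l, n)"
    using assms(1) unfolding row_shift_def
    by (subst (asm) eventually_sequentially_seg[where k = l, symmetric])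
  with assms(2)[unfolded row_shift_def] show ?thesis
    unfolding row_shift_def by eventually_elim (simp add: ac_simps)
qed

text \<open>On the bottom row the map is eventually a strictly increasing function \<open>g\<close>, so
  \<open>i - g i\<close> never increases and becomes constant once \<open>g i \<le> i\<close> is known.  If
  \<open>g K > K\<close>, then all points mapped into the first \<open>K\<close> columns come from the
  first \<open>K - 1\<close> columns.  A box of width \<open>K\<close> and height \<open>T\<close> would
  then receive its points from a box of width \<open>K - 1\<close> and height \<open>T\<close> up to a
  bounded error, the height being controlled by the leftmost column.  For large \<open>T\<close>
  there are too few points.\<close>

lemma row_shift_first_row:
  assumes "row_preserving \<alpha>"
  shows "\<exists>k. row_shift \<alpha> 1 k"
proof -
  have \<alpha>: "is_PO_inf \<alpha>" and row: "\<And>i k l. \<alpha> (i, 1) = Some (k, l) \<Longrightarrow> l = 1"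
    using assms unfolding row_preserving_def by blast+
  have "\<forall>\<^sub>F i in sequentially. (i, 1) \<in> dom (transpose_map \<alpha>)"
    using eventually_row_in[OF PO_inf_cofinite(1)[OF transpose_map_PO_inf[OF \<alpha>]], of 1] by simp
  moreover have "(i, 1) \<in> dom (transpose_map \<alpha>) \<longleftrightarrow> (1, i) \<in> dom \<alpha>" for i
    by (auto simp: transpose_map_def dom_def)
  ultimately have "\<forall>\<^sub>F i in sequentially. (i, 1) \<in> dom \<alpha> \<and> (1, i) \<in> dom \<alpha> \<and> 1 \<le> i"
    using eventually_row_in[OF PO_inf_cofinite(1)[OF \<alpha>], of 1] eventually_ge_at_top[of "1::nat"]
    by (simp add: eventually_conj_iff)
  then obtain N where N: "\<And>i. i \<ge> N \<Longrightarrow> (i, 1) \<in> dom \<alpha> \<and> (1, i) \<in> dom \<alpha>" and "1 \<le> N"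
    unfolding eventually_sequentially by blast
  define g where "g i = fst (the (\<alpha> (i, 1)))" for i
  define h where "h j = snd (the (\<alpha> (1, j)))" for j
  have g: "\<alpha> (i, 1) = Some (g i, 1)" if "i \<ge> N" for i
    using N[OF that] row[of i] by (auto simp: g_def)
  have h: "\<alpha> (1, j) = Some (1, h j)" if "j \<ge> N" for j
    using N[OF that] column_preserving[OF assms, of j] by (auto simp: h_def)
  have g_less: "g i < g (Suc i)" if "i \<ge> N" for i
    using PO_inf_mono[OF \<alpha> g g, of i "Suc i"] PO_inf_inj[OF \<alpha> g, of i "(Suc i, 1)"] g[of "Suc i"] that
    by (cases "g i = g (Suc i)") auto
  have h_less: "h i < h (Suc i)" if "i \<ge> N" for i
    using PO_inf_mono[OF \<alpha> h h, of i "Suc i"] PO_inf_inj[OF \<alpha> h, of i "(1, Suc i)"] h[of "Suc i"] that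
    by (cases "h i = h (Suc i)") auto
  have h_ge: "d \<le> h (N + d)" for d
  proof (induction d)
    case (Suc d)
    then show ?case using h_less[of "N + d"] by simp
  qed simp
  have g_le: "g K \<le> K" if "K \<ge> N" for K
  proof (rule ccontr)
    assume "\<not> g K \<le> K"
    define c where "c = card (quadrant - ran \<alpha>)"
    obtain k where k: "K = Suc k" using \<open>K \<ge> N\<close> \<open>1 \<le> N\<close> by (cases K) auto
    \<comment> \<open>The smallest height at which \<open>K * T \<le> k * (T + N) + c\<close> fails.\<close>
    define T where "T = k * N + c + 1"
    have "{1..K} \<times> {1..T} \<subseteq> (the \<circ> \<alpha>) ` ({1..k} \<times> {1..T + N}) \<union> (quadrant - ran \<alpha>)"
    proof safe
      fix u v assume uv: "u \<in> {1..K}" "v \<in> {1..T}"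
        and nr: "(u, v) \<notin> (the \<circ> \<alpha>) ` ({1..k} \<times> {1..T + N})"
      show "(u, v) \<in> quadrant" using uv by (simp add: mem_quadrant)
      assume "(u, v) \<in> ran \<alpha>"
      then obtain i j where ij: "\<alpha> (i, j) = Some (u, v)" by (auto simp: ran_def)
      have pos: "1 \<le> i" "1 \<le> j"
        using PO_inf_quadrant(1)[OF \<alpha> ij] by (auto simp: mem_quadrant)
      have "i \<le> k"
      proof (rule ccontr)
        assume "\<not> i \<le> k"
        then have "g K \<le> u"
          using PO_inf_mono[OF \<alpha> g[OF \<open>K \<ge> N\<close>] ij] pos k by simp
        then show False using uv \<open>\<not> g K \<le> K\<close> by simp
      qed
      moreover have "j \<le> T + N"
      proof (rule ccontr)
        assume j: "\<not> j \<le> T + N"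
        then have "h (N + (j - N)) \<le> v"
          using PO_inf_mono[OF \<alpha> h ij, of j] pos by simp
        then have "j - N \<le> v" using h_ge[of "j - N"] by linarith
        moreover have "v \<le> T" using uv by simp
        ultimately show False using j by linarith
      qed
      ultimately have "(i, j) \<in> {1..k} \<times> {1..T + N}" using pos by simp
      then show False using nr ij by (metis comp_apply image_eqI option.sel)
    qed
    then have "card ({1..K} \<times> {1..T}) \<le> card ((the \<circ> \<alpha>) ` ({1..k} \<times> {1..T + N}) \<union> (quadrant - ran \<alpha>))"
      by (intro card_mono) (simp_all add: PO_inf_cofinite(2)[OF \<alpha>])
    also have "\<dots> \<le> card ((the \<circ> \<alpha>) ` ({1..k} \<times> {1..T + N})) + c"
      unfolding c_def by (rule card_Un_le)
    also have "\<dots> \<le> card ({1..k} \<times> {1..T + N}) + c"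
      by (intro add_right_mono card_image_le) simp
    finally have "K * T \<le> k * (T + N) + c" by simp
    then have "T \<le> k * N + c" unfolding k by (simp add: algebra_simps)
    then show False by (simp add: T_def)
  qed
  \<comment> \<open>The displacement \<open>i - g i\<close> never increases, so it is constant from where its minimum is attained.\<close>
  define k where "k = (LEAST d. \<exists>i\<ge>N. d = i - g i)"
  obtain M where M: "M \<ge> N" "k = M - g M"
    using LeastI[of "\<lambda>d. \<exists>i\<ge>N. d = i - g i" "N - g N"] unfolding k_def by blast
  have k_le: "k \<le> i - g i" if "i \<ge> N" for i
    unfolding k_def using that by (intro Least_le) blast
  have const: "g (M + d) + k = M + d" for d
  proof (induction d)
    case 0
    show ?case using M g_le[of M] by simp
  next
    case (Suc d)
    have "g (M + d) < g (M + Suc d)" using g_less[of "M + d"] M by simp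
    moreover have "k \<le> M + Suc d - g (M + Suc d)" "g (M + Suc d) \<le> M + Suc d"
      using k_le[of "M + Suc d"] g_le[of "M + Suc d"] M by simp_all
    ultimately show ?case using Suc by linarith
  qed
  have "\<alpha> (i + k, 1) = Some (i, 1)" if "i \<ge> M" for i
  proof -
    have "g (i + k) = i"
      using const[of "i + k - M"] that by simp
    then show ?thesis using g[of "i + k"] M that by simp
  qed
  then show ?thesis
    unfolding row_shift_def eventually_sequentially by blast
qed

text \<open>The map induced on the rows above the bottom one, renumbered to start at 1 again.  Points
  that fall into the bottom row are dropped from the domain.\<close>

definition peel :: "(nat \<times> nat \<rightharpoonup> nat \<times> nat) \<Rightarrow> (nat \<times> nat \<rightharpoonup> nat \<times> nat)" where
  "peel \<alpha> p = (case \<alpha> (fst p, Suc (snd p)) of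
     None \<Rightarrow> None
   | Some (k, l) \<Rightarrow> if 1 \<le> snd p \<and> 2 \<le> l then Some (k, l - 1) else None)"

lemma peel_Some [simp]:
  "peel \<alpha> (i, j) = Some (k, l) \<longleftrightarrow> 1 \<le> j \<and> 1 \<le> l \<and> \<alpha> (i, Suc j) = Some (k, Suc l)"
  by (auto simp: peel_def split: option.splits)

text \<open>Only finitely many points are dropped, because the bottom row itself already covers all
  but finitely many points of the bottom row.  That the new bottom row is preserved is not a
  direct consequence of the hypothesis on the old one.  But the leftmost column is preserved by
  the new map as by the old one, and applying \<open>column_preserving\<close> to the reflected map
  turns this into the claim.\<close>

lemma peel_row_preserving:
  assumes "row_preserving \<alpha>"
  shows "row_preserving (peel \<alpha>)"
proof -
  have \<alpha>: "is_PO_inf \<alpha>" and row: "\<And>i k l. \<alpha> (i, 1) = Some (k, l) \<Longrightarrow> l = 1"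
    using assms unfolding row_preserving_def by blast+
  define up where "up p = (fst p, Suc (snd p))" for p :: "nat \<times> nat"
  have inj_up: "inj_on up A" for A
    by (auto simp: up_def inj_on_def)
  obtain s M where M: "\<And>i. i \<ge> M \<Longrightarrow> \<alpha> (i + s, 1) = Some (i, 1)"
    using row_shift_first_row[OF assms] by (auto simp: row_shift_def eventually_sequentially)
  define B where "B = {x. \<exists>y\<in>{..<M} \<times> {1}. \<alpha> x = Some y}"
  have B: "x \<in> B" if "\<alpha> x = Some (k, 1)" "snd x \<noteq> 1" for x k
  proof -
    have "k < M"
    proof (rule ccontr)
      assume "\<not> k < M"
      then have "x = (k + s, 1)" using PO_inf_inj[OF \<alpha> that(1) M[of k]] by simp
      then show False using that(2) by simp
    qed
    then show ?thesis using that(1) by (auto simp: B_def)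
  qed
  have "up ` (quadrant - dom (peel \<alpha>)) \<subseteq> (quadrant - dom \<alpha>) \<union> B"
  proof (rule image_subsetI)
    fix p assume p: "p \<in> quadrant - dom (peel \<alpha>)"
    obtain i j where ij: "p = (i, j)" "1 \<le> i" "1 \<le> j"
      using p by (cases p) (auto simp: mem_quadrant)
    show "up p \<in> (quadrant - dom \<alpha>) \<union> B"
    proof (cases "\<alpha> (i, Suc j)")
      case None
      then show ?thesis using ij by (auto simp: up_def mem_quadrant)
    next
      case (Some y)
      obtain k l where y: "y = (k, l)" by fastforce
      have "1 \<le> l" using PO_inf_quadrant(2)[OF \<alpha> Some] by (simp add: y mem_quadrant)
      have "l = 1"
      proof (rule ccontr)
        assume "l \<noteq> 1"
        then have "peel \<alpha> (i, j) = Some (k, l - 1)" using Some ij y \<open>1 \<le> l\<close> by simp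
        then show False using p ij by (metis DiffD2 domI)
      qed
      then show ?thesis using B[of "(i, Suc j)" k] Some ij y by (simp add: up_def)
    qed
  qed
  moreover have "finite B"
    unfolding B_def by (intro finite_PO_inf_preimage[OF \<alpha>]) simp
  ultimately have dom: "finite (quadrant - dom (peel \<alpha>))"
    using inj_up PO_inf_cofinite(1)[OF \<alpha>] by (meson finite_UnI finite_imageD finite_subset)
  have "up ` (quadrant - ran (peel \<alpha>)) \<subseteq> quadrant - ran \<alpha>"
  proof (rule image_subsetI)
    fix p assume p: "p \<in> quadrant - ran (peel \<alpha>)"
    obtain k l where kl: "p = (k, l)" "1 \<le> k" "1 \<le> l"
      using p by (cases p) (auto simp: mem_quadrant)
    have False if a: "\<alpha> (i, j) = Some (k, Suc l)" for i j
    proof -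
      have "j \<noteq> 1" using row[of i k "Suc l"] a kl by auto
      moreover have "1 \<le> j" using PO_inf_quadrant(1)[OF \<alpha> a] by (simp add: mem_quadrant)
      ultimately have "peel \<alpha> (i, j - 1) = Some (k, l)" using a kl by simp
      then show False using p kl by (auto simp: ran_def)
    qed
    then show "up p \<in> quadrant - ran \<alpha>"
      using kl by (auto simp: up_def mem_quadrant ran_def)
  qed
  then have ran: "finite (quadrant - ran (peel \<alpha>))"
    using inj_up PO_inf_cofinite(2)[OF \<alpha>] by (meson finite_imageD finite_subset)
  have PO: "is_PO_inf (peel \<alpha>)"
    unfolding is_PO_inf_iff
  proof (intro conjI allI impI)
    fix x y assume a: "peel \<alpha> x = Some y"
    obtain i j k l where xy: "x = (i, j)" "y = (k, l)" by (metis surj_pair)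
    then have "\<alpha> (i, Suc j) = Some (k, Suc l)" "1 \<le> j" "1 \<le> l" using a by simp_all
    then show "x \<in> quadrant" "y \<in> quadrant"
      using PO_inf_quadrant[OF \<alpha>, of "(i, Suc j)" "(k, Suc l)"] by (simp_all add: xy mem_quadrant)
  next
    fix x x' y assume "peel \<alpha> x = Some y" "peel \<alpha> x' = Some y"
    then show "x = x'"
      using PO_inf_inj[OF \<alpha>, of "up x" "up y" "up x'"]
      by (cases x; cases x'; cases y) (simp add: up_def)
  next
    fix x x' y y'
    assume "peel \<alpha> x = Some y" "peel \<alpha> x' = Some y'" "x \<le> x'"
    then show "y \<le> y'"
      using PO_inf_mono[OF \<alpha>, of "fst x" "Suc (snd x)" "fst y" "Suc (snd y)"
          "fst x'" "Suc (snd x')" "fst y'" "Suc (snd y')"]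
      by (cases x; cases x'; cases y; cases y') simp
  qed (fact dom ran)+
  have "l = 1" if "transpose_map (peel \<alpha>) (i, 1) = Some (k, l)" for i k l
    using that column_preserving[OF assms, of "Suc i" l "Suc k"] by simp
  then have "row_preserving (transpose_map (peel \<alpha>))"
    using transpose_map_PO_inf[OF PO] by (simp add: row_preserving_def)
  then show ?thesis
    using transpose_map_row_preserving by fastforce
qed

lemma ex_row_shift:
  assumes "row_preserving \<alpha>"
  shows "\<exists>k. row_shift \<alpha> (Suc n) k"
  using assms
proof (induction n arbitrary: \<alpha>)
  case 0
  then show ?case using row_shift_first_row by simp
next
  case (Suc n)
  then obtain k where "row_shift (peel \<alpha>) (Suc n) k"
    using peel_row_preserving by blast
  then have "row_shift \<alpha> (Suc (Suc n)) k"
    unfolding row_shift_def by (rule eventually_mono) simp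
  then show ?case ..
qed

text \<open>A point of the row \<open>j\<close> lies to the left of points of the same row that stay in
  that row, and monotonicity bounds its image by theirs.\<close>

lemma row_index_decreasing:
  assumes "row_preserving \<alpha>" "\<alpha> (i, j) = Some (k, l)"
  shows "l \<le> j"
proof -
  have \<alpha>: "is_PO_inf \<alpha>" using assms(1) by (simp add: row_preserving_def)
  have "1 \<le> j" using PO_inf_quadrant(1)[OF \<alpha> assms(2)] by (simp add: mem_quadrant)
  then obtain s N where N: "\<And>i. i \<ge> N \<Longrightarrow> \<alpha> (i + s, j) = Some (i, j)"
    using ex_row_shift[OF assms(1), of "j - 1"] by (auto simp: row_shift_def eventually_sequentially)
  show ?thesis
    using PO_inf_mono[OF \<alpha> assms(2) N[of "max i N"]] by simp
qed

lemma row_shift_antimono: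
  assumes "row_preserving \<alpha>" "row_shift \<alpha> m k" "row_shift \<alpha> n l" "m \<le> n"
  shows "l \<le> k"
proof -
  have \<alpha>: "is_PO_inf \<alpha>" using assms(1) by (simp add: row_preserving_def)
  obtain N where N: "\<And>i. i \<ge> N \<Longrightarrow> \<alpha> (i + k, m) = Some (i, m) \<and> \<alpha> (i + l, n) = Some (i, n)"
    using eventually_conj[OF assms(2,3)[unfolded row_shift_def]] by (auto simp: eventually_sequentially)
  have "\<alpha> (N + l + k, m) = Some (N + l, m)" "\<alpha> (N + l + k, n) = Some (N + k, n)"
    using N[of "N + l"] N[of "N + k"] by (simp_all add: ac_simps)
  then show ?thesis
    using PO_inf_mono[OF \<alpha>, of "N + l + k" m "N + l" m "N + l + k" n "N + k" n] assms(4) by simp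
qed

text \<open>By \<open>row_index_decreasing\<close> and its reflection, the image of a point in the box
  stays in the box.  If every row were shifted, each row of a wide enough box would in addition
  receive a point from the right of the box.  With more rows than missing domain points this
  contradicts injectivity.\<close>

lemma ex_row_shift_0:
  assumes "row_preserving \<alpha>"
  shows "\<exists>n. row_shift \<alpha> (Suc n) 0"
proof (rule ccontr)
  assume no: "\<nexists>n. row_shift \<alpha> (Suc n) 0"
  have \<alpha>: "is_PO_inf \<alpha>" using assms by (simp add: row_preserving_def)
  obtain a where a: "\<And>n. row_shift \<alpha> (Suc n) (a n)"
    using ex_row_shift[OF assms] by metis
  have pos: "a n \<noteq> 0" for n using a[of n] no by metis
  define c where "c = card (quadrant - dom \<alpha>)"
  \<comment> \<open>A width at which all of the first \<open>c + 1\<close> rows have reached their translation.\<close>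
  have "\<forall>\<^sub>F i in sequentially. \<forall>n\<in>{..c}. \<alpha> (i + a n, Suc n) = Some (i, Suc n)"
    using a by (intro eventually_ball_finite) (auto simp: row_shift_def)
  with eventually_ge_at_top[of 1]
  have "\<forall>\<^sub>F i in sequentially. 1 \<le> i \<and> (\<forall>n\<in>{..c}. \<alpha> (i + a n, Suc n) = Some (i, Suc n))"
    by (rule eventually_conj)
  then obtain K where K: "1 \<le> K" "\<And>n. n \<le> c \<Longrightarrow> \<alpha> (K + a n, Suc n) = Some (K, Suc n)"
    by (auto simp: eventually_sequentially)
  define box where "box = {1..K} \<times> {1..Suc c}"
  define enter where "enter = (\<lambda>n. (K + a n, Suc n)) ` {..c}"
  have fin: "finite box" "finite enter" by (simp_all add: box_def enter_def)
  have "card box \<le> card (box \<inter> dom \<alpha> \<union> (quadrant - dom \<alpha>))"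
    using fin PO_inf_cofinite(1)[OF \<alpha>] by (intro card_mono) (auto simp: box_def mem_quadrant)
  also have "\<dots> \<le> card (box \<inter> dom \<alpha>) + c"
    unfolding c_def by (rule card_Un_le)
  finally have "card box \<le> card (box \<inter> dom \<alpha>) + c" .
  moreover have "card enter = Suc c"
    unfolding enter_def by (subst card_image) (auto simp: inj_on_def)
  moreover have "box \<inter> enter = {}"
  proof (rule equals0I)
    fix p assume "p \<in> box \<inter> enter"
    then obtain n where "a n = 0" by (auto simp: box_def enter_def)
    then show False using pos[of n] by simp
  qed
  then have "card (box \<inter> dom \<alpha> \<union> enter) = card (box \<inter> dom \<alpha>) + card enter"
    using fin by (intro card_Un_disjoint) auto
  moreover have "card (box \<inter> dom \<alpha> \<union> enter) \<le> card box"
  proof (rule card_inj_on_le)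
    have defined: "\<exists>y\<in>box. \<alpha> x = Some y" if "x \<in> box \<inter> dom \<alpha> \<union> enter" for x
      using that
    proof
      assume x: "x \<in> box \<inter> dom \<alpha>"
      then obtain i j k l where kl: "x = (i, j)" "\<alpha> (i, j) = Some (k, l)"
        by (cases x) auto
      have "l \<le> j" by (rule row_index_decreasing[OF assms kl(2)])
      moreover have "k \<le> i"
        using row_index_decreasing[OF transpose_map_row_preserving[OF assms], of j i l k] kl(2) by simp
      moreover have "1 \<le> k" "1 \<le> l"
        using PO_inf_quadrant(2)[OF \<alpha> kl(2)] by (simp_all add: mem_quadrant)
      ultimately show ?thesis using x kl by (auto simp: box_def)
    next
      assume "x \<in> enter"
      then show ?thesis using K by (auto simp: enter_def box_def)
    qed
    then show "(the \<circ> \<alpha>) ` (box \<inter> dom \<alpha> \<union> enter) \<subseteq> box"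
      by fastforce
    show "inj_on (the \<circ> \<alpha>) (box \<inter> dom \<alpha> \<union> enter)"
    proof (rule inj_onI)
      fix x x' assume "x \<in> box \<inter> dom \<alpha> \<union> enter" "x' \<in> box \<inter> dom \<alpha> \<union> enter"
        "(the \<circ> \<alpha>) x = (the \<circ> \<alpha>) x'"
      then show "x = x'"
        using defined[of x] defined[of x'] PO_inf_inj[OF \<alpha>, of x _ x'] by auto
    qed
  qed (fact fin)
  ultimately show False by simp
qed

section \<open>Partitions as multisets\<close>

text \<open>A multiset of natural numbers encodes the decreasing sequence of its tail counts; an
  element \<open>m\<close> contributes the sequence with ones at the positions \<open>0, \<dots>, m\<close>.
  Union of multisets corresponds to pointwise addition.\<close>

definition tail_count :: "nat multiset \<Rightarrow> nat \<Rightarrow> nat" where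
  "tail_count M n = size {#m \<in># M. n \<le> m#}"

lemma tail_count_simps [simp]:
  "tail_count {#} n = 0"
  "tail_count (M + N) n = tail_count M n + tail_count N n"
  "tail_count (replicate_mset c m) n = (if n \<le> m then c else 0)"
  by (induction c; simp add: tail_count_def)+

lemma tail_count_singleton [simp]: "tail_count {#m#} n = (if n \<le> m then 1 else 0)"
  by (simp add: tail_count_def)

lemma tail_count_inject:
  assumes "\<And>n. tail_count M n = tail_count N n"
  shows "M = N"
proof (rule multiset_eqI)
  have "count M n + tail_count M (Suc n) = tail_count M n" for M n
    by (induction M) (auto simp: tail_count_def)
  then show "count M n = count N n" for n
    using assms by (metis add_right_cancel)
qed

text \<open>Subtracting the last value \<open>a N\<close> that can be nonzero from the whole sequence shortens the
  support and is undone by adding \<open>a N\<close> copies of \<open>N\<close>.\<close>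

lemma ex_tail_count:
  fixes a :: "nat \<Rightarrow> nat"
  assumes "antimono a" "a N = 0"
  shows "\<exists>M. \<forall>n. tail_count M n = a n"
  using assms
proof (induction N arbitrary: a)
  case 0
  then have "a n = 0" for n by (metis antimonoD le0 le_zero_eq)
  then show ?case by (intro exI[of _ "{#}"]) simp
next
  case (Suc N)
  have "antimono (\<lambda>n. a n - a N)"
    using \<open>antimono a\<close> by (simp add: antimono_def diff_le_mono)
  then obtain M where M: "tail_count M n = a n - a N" for n
    using Suc.IH[of "\<lambda>n. a n - a N"] by auto
  have "tail_count (M + replicate_mset (a N) N) n = a n" for n
  proof (cases "n \<le> N")
    case True
    then show ?thesis using antimonoD[OF \<open>antimono a\<close> True] by (simp add: M)
  next
    case False
    then have "a n \<le> a (Suc N)" using antimonoD[OF \<open>antimono a\<close>] by simp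
    then show ?thesis using False Suc.prems(2) by (simp add: M)
  qed
  then show ?case by blast
qed

text \<open>Rows are numbered from 1 and multiset elements from 0, hence the \<open>Suc\<close>.\<close>

definition row_partition :: "(nat \<times> nat \<rightharpoonup> nat \<times> nat) \<Rightarrow> nat multiset" where
  "row_partition \<alpha> = (THE M. \<forall>n. row_shift \<alpha> (Suc n) (tail_count M n))"

lemma row_partition_eqI:
  assumes "\<And>n. row_shift \<alpha> (Suc n) (tail_count M n)"
  shows "row_partition \<alpha> = M"
  unfolding row_partition_def
  using assms row_shift_unique tail_count_inject by (intro the_equality) blast+

lemma row_shift_row_partition:
  assumes "row_preserving \<alpha>"
  shows "row_shift \<alpha> (Suc n) (tail_count (row_partition \<alpha>) n)"
proof -
  obtain a where a: "\<And>n. row_shift \<alpha> (Suc n) (a n)"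
    using ex_row_shift[OF assms] by metis
  have "antimono a"
    by (intro antimonoI row_shift_antimono[OF assms a a]) simp
  moreover obtain N where "a N = 0"
    using ex_row_shift_0[OF assms] a row_shift_unique by blast
  ultimately obtain M where "\<And>n. tail_count M n = a n"
    using ex_tail_count by blast
  then show ?thesis
    using a row_partition_eqI[of \<alpha> M] by simp
qed

lemma row_partition_comp:
  assumes "row_preserving \<alpha>" "row_preserving \<beta>"
  shows "row_partition (\<beta> \<circ>\<^sub>m \<alpha>) = row_partition \<alpha> + row_partition \<beta>"
  using assms by (intro row_partition_eqI) (simp add: row_shift_comp row_shift_row_partition)

section \<open>The two partitions determine the germ\<close>

text \<open>Both coordinates can only decrease.  Conversely, a point far to the right and above a row
  with shift 0 lies above a fixed point in the same column, so its first coordinate cannot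
  decrease; the second coordinate follows by reflection.\<close>

lemma identity_near_infinity:
  assumes "row_preserving \<alpha>"
  shows "\<exists>N. \<forall>i\<ge>N. \<forall>j\<ge>N. \<forall>y. \<alpha> (i, j) = Some y \<longrightarrow> y = (i, j)"
proof -
  have fst_ge: "\<exists>N. \<forall>i\<ge>N. \<forall>j\<ge>N. \<forall>k l. \<alpha> (i, j) = Some (k, l) \<longrightarrow> i \<le> k"
    if "row_preserving \<alpha>" for \<alpha>
  proof -
    have \<alpha>: "is_PO_inf \<alpha>" using that by (simp add: row_preserving_def)
    obtain n N where N: "\<And>i. i \<ge> N \<Longrightarrow> \<alpha> (i, Suc n) = Some (i, Suc n)"
      using ex_row_shift_0[OF \<open>row_preserving \<alpha>\<close>]
      by (auto simp: row_shift_def eventually_sequentially)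
    have "i \<le> k" if "i \<ge> max N (Suc n)" "j \<ge> max N (Suc n)" "\<alpha> (i, j) = Some (k, l)" for i j k l
      using PO_inf_mono[OF \<alpha> N[of i] that(3)] that by simp
    then show ?thesis by (intro exI[of _ "max N (Suc n)"]) simp
  qed
  obtain N1 where N1: "\<And>i j k l. i \<ge> N1 \<Longrightarrow> j \<ge> N1 \<Longrightarrow> \<alpha> (i, j) = Some (k, l) \<Longrightarrow> i \<le> k"
    using fst_ge[OF assms] by blast
  obtain N2 where N2: "\<And>i j k l. i \<ge> N2 \<Longrightarrow> j \<ge> N2 \<Longrightarrow> \<alpha> (j, i) = Some (l, k) \<Longrightarrow> i \<le> k"
    using fst_ge[OF transpose_map_row_preserving[OF assms]] unfolding transpose_map_Some by blast
  show ?thesis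
  proof (intro exI[of _ "max N1 N2"] allI impI)
    fix i j y assume ij: "max N1 N2 \<le> i" "max N1 N2 \<le> j" and "\<alpha> (i, j) = Some y"
    moreover obtain k l where y: "y = (k, l)" by fastforce
    ultimately have kl: "\<alpha> (i, j) = Some (k, l)" by simp
    have "l \<le> j" by (rule row_index_decreasing[OF assms kl])
    moreover have "k \<le> i"
      using row_index_decreasing[OF transpose_map_row_preserving[OF assms], of j i l k] kl by simp
    moreover have "i \<le> k" by (rule N1[OF _ _ kl]) (use ij in simp_all)
    moreover have "j \<le> l" by (rule N2[OF _ _ kl]) (use ij in simp_all)
    ultimately show "y = (i, j)" by (simp add: y)
  qed
qed

lemma row_shift_cong:
  assumes "row_shift \<alpha> n k" "finite {x. \<alpha> x \<noteq> \<beta> x}"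
  shows "row_shift \<beta> n k"
proof -
  have "\<forall>\<^sub>F i in sequentially. \<alpha> (i + k, n) = \<beta> (i + k, n)"
    using eventually_row_notin[OF assms(2), of n]
    by (subst eventually_sequentially_seg[where k = k]) simp
  with assms(1)[unfolded row_shift_def] show ?thesis
    unfolding row_shift_def by eventually_elim simp
qed

lemma finite_row_difference:
  assumes "row_shift \<alpha> n k" "row_shift \<beta> n k"
  shows "finite {i. \<alpha> (i, n) \<noteq> \<beta> (i, n)}"
proof -
  have "\<forall>\<^sub>F i in sequentially. \<alpha> (i + k, n) = \<beta> (i + k, n)"
    using assms unfolding row_shift_def by eventually_elim simp
  then have "\<forall>\<^sub>F i in sequentially. \<alpha> (i, n) = \<beta> (i, n)"
    by (subst (asm) eventually_sequentially_seg[where k = k]) simp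
  then show ?thesis
    by (simp add: eventually_cofinite flip: cofinite_eq_sequentially)
qed

lemma finite_transpose_difference:
  assumes "finite {x. \<alpha> x \<noteq> \<beta> x}"
  shows "finite {x. transpose_map \<alpha> x \<noteq> transpose_map \<beta> x}"
proof (rule finite_subset)
  show "{x. transpose_map \<alpha> x \<noteq> transpose_map \<beta> x} \<subseteq> prod.swap ` {x. \<alpha> x \<noteq> \<beta> x}"
    by (auto simp: transpose_map_def)
qed (use assms in simp)

text \<open>If the partitions agree, the maps agree near infinity in each single row and column, and
  outside finitely many rows and columns both are the identity wherever they are defined.\<close>

lemma finite_difference_iff:
  assumes "row_preserving \<alpha>" "row_preserving \<beta>"
  shows "finite {x. \<alpha> x \<noteq> \<beta> x} \<longleftrightarrow>
    row_partition \<alpha> = row_partition \<beta> \<and>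
    row_partition (transpose_map \<alpha>) = row_partition (transpose_map \<beta>)"
proof
  have eq: "row_partition \<alpha> = row_partition \<beta>"
    if "finite {x. \<alpha> x \<noteq> \<beta> x}" "row_preserving \<alpha>" for \<alpha> \<beta>
    using row_shift_cong[OF row_shift_row_partition[OF that(2)] that(1)]
    by (intro row_partition_eqI[symmetric])
  assume "finite {x. \<alpha> x \<noteq> \<beta> x}"
  then show "row_partition \<alpha> = row_partition \<beta> \<and>
      row_partition (transpose_map \<alpha>) = row_partition (transpose_map \<beta>)"
    using eq finite_transpose_difference assms transpose_map_row_preserving by simp
next
  assume eq: "row_partition \<alpha> = row_partition \<beta> \<and>
    row_partition (transpose_map \<alpha>) = row_partition (transpose_map \<beta>)"
  have \<alpha>: "is_PO_inf \<alpha>" and \<beta>: "is_PO_inf \<beta>"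
    using assms by (simp_all add: row_preserving_def)
  note T = transpose_map_row_preserving[OF assms(1)] transpose_map_row_preserving[OF assms(2)]
  have row: "finite {i. \<alpha> (i, n) \<noteq> \<beta> (i, n)}"
    if "row_partition \<alpha> = row_partition \<beta>" "row_preserving \<alpha>" "row_preserving \<beta>" for \<alpha> \<beta> n
  proof (cases n)
    case 0
    have "\<gamma> (i, 0) = None" if "row_preserving \<gamma>" for \<gamma> i
      using that PO_inf_quadrant(1)[of \<gamma> "(i, 0)"] unfolding row_preserving_def
      by (cases "\<gamma> (i, 0)") (auto simp: mem_quadrant)
    then have "\<alpha> (i, n) = \<beta> (i, n)" for i using 0 that(2,3) by metis
    then show ?thesis by simp
  next
    case (Suc m)
    then show ?thesis
      using finite_row_difference row_shift_row_partition that by metis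
  qed
  have rows: "finite {i. \<alpha> (i, n) \<noteq> \<beta> (i, n)}" for n
    using row eq assms by blast
  have cols: "finite {j. \<alpha> (n, j) \<noteq> \<beta> (n, j)}" for n
  proof (rule finite_subset)
    show "{j. \<alpha> (n, j) \<noteq> \<beta> (n, j)} \<subseteq> {j. transpose_map \<alpha> (j, n) \<noteq> transpose_map \<beta> (j, n)}"
      by (simp add: transpose_map_eq_iff)
  qed (use row eq T in blast)
  obtain N1 where N1: "\<forall>i\<ge>N1. \<forall>j\<ge>N1. \<forall>y. \<alpha> (i, j) = Some y \<longrightarrow> y = (i, j)"
    using identity_near_infinity[OF assms(1)] by blast
  obtain N2 where N2: "\<forall>i\<ge>N2. \<forall>j\<ge>N2. \<forall>y. \<beta> (i, j) = Some y \<longrightarrow> y = (i, j)"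
    using identity_near_infinity[OF assms(2)] by blast
  define N where "N = max N1 N2"
  have "{x. \<alpha> x \<noteq> \<beta> x} \<subseteq> (quadrant - dom \<alpha>) \<union> (quadrant - dom \<beta>) \<union>
      (\<Union>n<N. (\<lambda>i. (i, n)) ` {i. \<alpha> (i, n) \<noteq> \<beta> (i, n)}) \<union>
      (\<Union>n<N. (\<lambda>j. (n, j)) ` {j. \<alpha> (n, j) \<noteq> \<beta> (n, j)})" (is "_ \<subseteq> ?A \<union> ?B \<union> ?R \<union> ?C")
  proof
    fix x assume "x \<in> {x. \<alpha> x \<noteq> \<beta> x}"
    then have ne: "\<alpha> x \<noteq> \<beta> x" by simp
    obtain i j where x: "x = (i, j)" by (metis surj_pair)
    have Q: "x \<in> quadrant"
      using ne PO_inf_quadrant(1)[OF \<alpha>, of x] PO_inf_quadrant(1)[OF \<beta>, of x]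
      by (cases "\<alpha> x"; cases "\<beta> x") auto
    consider "j < N" | "i < N" | "N \<le> i" "N \<le> j" by linarith
    then show "x \<in> ?A \<union> ?B \<union> ?R \<union> ?C"
    proof cases
      case 1
      then have "x \<in> ?R" using ne x by blast
      then show ?thesis by blast
    next
      case 2
      then have "x \<in> ?C" using ne x by blast
      then show ?thesis by blast
    next
      case 3
      then have "y = x" if "\<alpha> x = Some y \<or> \<beta> x = Some y" for y
        using that N1[rule_format, of i j y] N2[rule_format, of i j y] 3 by (auto simp: x N_def)
      then have "\<alpha> x = None \<or> \<beta> x = None"
        using ne by (cases "\<alpha> x"; cases "\<beta> x") auto
      then show ?thesis using Q by auto
    qed
  qed
  then show "finite {x. \<alpha> x \<noteq> \<beta> x}"
    by (rule finite_subset)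
      (simp add: rows cols PO_inf_cofinite(1)[OF \<alpha>] PO_inf_cofinite(1)[OF \<beta>])
qed

section \<open>The relation \<open>\<sigma>\<close> as equality up to finitely many points\<close>

lemma identity_on_PO_inf:
  assumes "E \<subseteq> quadrant" "finite (quadrant - E)"
  shows "is_PO_inf (Some |` E)"
proof -
  have "dom (Some |` E) = E" "ran (Some |` E) = E"
    by (auto simp: restrict_map_def ran_def split: if_splits)
  then show ?thesis
    using assms unfolding is_PO_inf_iff
    by (auto simp: restrict_map_def split: if_splits)
qed

text \<open>An idempotent is the identity on a cofinite set, so composing with it removes only finitely
  many points.  Conversely, for maps that differ on a finite set, the identity outside the images
  of that set is an idempotent that equalises them.\<close>

lemma sigma_rel_iff:
  "(\<alpha>, \<beta>) \<in> sigma_rel \<longleftrightarrow> is_PO_inf \<alpha> \<and> is_PO_inf \<beta> \<and> finite {x. \<alpha> x \<noteq> \<beta> x}"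
proof -
  have "(\<exists>\<epsilon>\<in>idempotents PO_inf. \<alpha> \<otimes>\<^bsub>PO_inf\<^esub> \<epsilon> = \<beta> \<otimes>\<^bsub>PO_inf\<^esub> \<epsilon>) \<longleftrightarrow> finite {x. \<alpha> x \<noteq> \<beta> x}"
    if \<alpha>: "is_PO_inf \<alpha>" and \<beta>: "is_PO_inf \<beta>"
  proof
    assume "\<exists>\<epsilon>\<in>idempotents PO_inf. \<alpha> \<otimes>\<^bsub>PO_inf\<^esub> \<epsilon> = \<beta> \<otimes>\<^bsub>PO_inf\<^esub> \<epsilon>"
    then obtain \<epsilon> where \<epsilon>: "is_PO_inf \<epsilon>" and idem: "\<epsilon> \<circ>\<^sub>m \<epsilon> = \<epsilon>" and eq: "\<epsilon> \<circ>\<^sub>m \<alpha> = \<epsilon> \<circ>\<^sub>m \<beta>"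
      by (auto simp: idempotents_def PO_inf_def)
    have id: "z = y" if "\<epsilon> y = Some z" for y z
    proof -
      have "\<epsilon> z = Some z"
        using that fun_cong[OF idem, of y] by (simp add: map_comp_def)
      then show ?thesis using PO_inf_inj[OF \<epsilon>] that by blast
    qed
    have agree: "\<gamma> x = \<delta> x" if "\<epsilon> \<circ>\<^sub>m \<gamma> = \<epsilon> \<circ>\<^sub>m \<delta>" "\<gamma> x = Some y" "y \<in> dom \<epsilon>" for \<gamma> \<delta> x y
    proof -
      obtain z where z: "\<epsilon> y = Some z" using \<open>y \<in> dom \<epsilon>\<close> by blast
      have "(\<epsilon> \<circ>\<^sub>m \<delta>) x = Some z"
        using that z by (simp flip: that(1))
      then obtain y' where "\<delta> x = Some y'" "\<epsilon> y' = Some z" by (auto simp: map_comp_Some_iff)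
      then show ?thesis using id z that(2) by metis
    qed
    have "{x. \<alpha> x \<noteq> \<beta> x} \<subseteq>
        {x. \<exists>y\<in>quadrant - dom \<epsilon>. \<alpha> x = Some y} \<union> {x. \<exists>y\<in>quadrant - dom \<epsilon>. \<beta> x = Some y}"
    proof
      fix x assume "x \<in> {x. \<alpha> x \<noteq> \<beta> x}"
      then have ne: "\<alpha> x \<noteq> \<beta> x" by simp
      show "x \<in> {x. \<exists>y\<in>quadrant - dom \<epsilon>. \<alpha> x = Some y} \<union> {x. \<exists>y\<in>quadrant - dom \<epsilon>. \<beta> x = Some y}"
      proof (cases "\<alpha> x")
        case (Some y)
        then show ?thesis
          using agree[OF eq Some] ne PO_inf_quadrant(2)[OF \<alpha> Some] by auto
      next
        case None
        then obtain y where "\<beta> x = Some y" using ne by (cases "\<beta> x") auto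
        then show ?thesis
          using agree[OF eq[symmetric], of x y] ne PO_inf_quadrant(2)[OF \<beta>, of x y] by auto
      qed
    qed
    then show "finite {x. \<alpha> x \<noteq> \<beta> x}"
      by (rule finite_subset)
        (intro finite_UnI finite_PO_inf_preimage \<alpha> \<beta> PO_inf_cofinite(1)[OF \<epsilon>])
  next
    assume fin: "finite {x. \<alpha> x \<noteq> \<beta> x}" (is "finite ?B")
    define E where "E = quadrant - (the \<circ> \<alpha>) ` ?B - (the \<circ> \<beta>) ` ?B"
    define \<epsilon> where "\<epsilon> = Some |` E"
    have "quadrant - E \<subseteq> (the \<circ> \<alpha>) ` ?B \<union> (the \<circ> \<beta>) ` ?B"
      by (auto simp: E_def)
    then have "finite (quadrant - E)"
      by (rule finite_subset) (intro finite_UnI finite_imageI fin)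
    then have "is_PO_inf \<epsilon>"
      unfolding \<epsilon>_def by (intro identity_on_PO_inf) (auto simp: E_def)
    moreover have "\<epsilon> \<circ>\<^sub>m \<epsilon> = \<epsilon>"
      by (auto simp: \<epsilon>_def map_comp_def restrict_map_def fun_eq_iff)
    moreover have "(\<epsilon> \<circ>\<^sub>m \<alpha>) x = (\<epsilon> \<circ>\<^sub>m \<beta>) x" for x
    proof (cases "\<alpha> x = \<beta> x")
      case False
      have "(\<epsilon> \<circ>\<^sub>m \<gamma>) x = None" if "E \<inter> (the \<circ> \<gamma>) ` ?B = {}" for \<gamma>
      proof (cases "\<gamma> x")
        case (Some y)
        then have "y \<in> (the \<circ> \<gamma>) ` ?B" using False by force
        then show ?thesis using Some that by (auto simp: \<epsilon>_def restrict_map_def)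
      qed simp
      then show ?thesis by (simp add: E_def Diff_eq)
    qed (simp add: map_comp_def)
    ultimately show "\<exists>\<epsilon>\<in>idempotents PO_inf. \<alpha> \<otimes>\<^bsub>PO_inf\<^esub> \<epsilon> = \<beta> \<otimes>\<^bsub>PO_inf\<^esub> \<epsilon>"
      by (intro bexI[of _ \<epsilon>]) (auto simp: idempotents_def PO_inf_def)
  qed
  then show ?thesis
    unfolding sigma_rel_def by (auto simp: PO_inf_def)
qed

section \<open>Realising all pairs of partitions\<close>

definition shift_first_rows :: "nat \<Rightarrow> (nat \<times> nat \<rightharpoonup> nat \<times> nat)" where
  "shift_first_rows n p =
     (if p \<in> quadrant
      then if snd p \<le> n then if fst p = 1 then None else Some (fst p - 1, snd p) else Some p
      else None)"

lemma shift_first_rows_Some: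
  "shift_first_rows n (i, j) = Some (k, l) \<longleftrightarrow>
     l = j \<and> 1 \<le> j \<and> 1 \<le> k \<and> i = (if j \<le> n then Suc k else k)"
  by (auto simp: shift_first_rows_def mem_quadrant)

lemma shift_first_rows_row_preserving: "row_preserving (shift_first_rows n)"
proof -
  have "quadrant - dom (shift_first_rows n) \<subseteq> {1} \<times> {..n}"
  proof
    fix p assume "p \<in> quadrant - dom (shift_first_rows n)"
    then show "p \<in> {1} \<times> {..n}"
      by (cases p) (auto simp: shift_first_rows_def dom_def split: if_splits)
  qed
  then have dom: "finite (quadrant - dom (shift_first_rows n))"
    by (rule finite_subset) simp
  have "quadrant - ran (shift_first_rows n) = {}"
  proof -
    have "(k, l) \<in> ran (shift_first_rows n)" if "(k, l) \<in> quadrant" for k l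
      using that shift_first_rows_Some[of n "if l \<le> n then Suc k else k" l k l]
      unfolding ran_def mem_quadrant by blast
    then show ?thesis by auto
  qed
  then have ran: "finite (quadrant - ran (shift_first_rows n))" by (simp only: finite.emptyI)
  have "is_PO_inf (shift_first_rows n)"
    unfolding is_PO_inf_iff
  proof (intro conjI allI impI)
    fix x y assume "shift_first_rows n x = Some y"
    then show "x \<in> quadrant" "y \<in> quadrant"
      by (cases x; cases y; simp add: shift_first_rows_Some mem_quadrant)+
  next
    fix x x' y assume "shift_first_rows n x = Some y" "shift_first_rows n x' = Some y"
    then show "x = x'"
      by (cases x; cases x'; cases y) (simp add: shift_first_rows_Some)
  next
    fix x x' y y'
    assume "shift_first_rows n x = Some y" "shift_first_rows n x' = Some y'" "x \<le> x'"
    then show "y \<le> y'"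
      by (cases x; cases x'; cases y; cases y') (simp add: shift_first_rows_Some split: if_splits)
  qed (fact dom ran)+
  then show ?thesis
    by (simp add: row_preserving_def shift_first_rows_Some)
qed

lemma row_partition_shift_first_rows:
  "row_partition (shift_first_rows (Suc n)) = {#n#}"
proof (rule row_partition_eqI)
  show "row_shift (shift_first_rows (Suc n)) (Suc m) (tail_count {#n#} m)" for m
    unfolding row_shift_def using eventually_ge_at_top[of 1]
    by eventually_elim (simp add: shift_first_rows_Some)
qed

lemma row_partition_transpose_shift_first_rows:
  "row_partition (transpose_map (shift_first_rows n)) = {#}"
proof (rule row_partition_eqI)
  show "row_shift (transpose_map (shift_first_rows n)) (Suc m) (tail_count {#} m)" for m
    unfolding row_shift_def using eventually_gt_at_top[of n]
    by eventually_elim (simp add: shift_first_rows_Some)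
qed

text \<open>The realised pairs are closed under addition and under exchanging the components, and they
  contain the pair of empty multisets and \<open>({#n#}, {#})\<close> for all \<open>n\<close>.\<close>

lemma row_partition_surj:
  "\<exists>\<alpha>. row_preserving \<alpha> \<and> row_partition \<alpha> = M \<and> row_partition (transpose_map \<alpha>) = N"
proof -
  define realised where "realised M N \<longleftrightarrow>
    (\<exists>\<alpha>. row_preserving \<alpha> \<and> row_partition \<alpha> = M \<and> row_partition (transpose_map \<alpha>) = N)" for M N
  have sum: "realised (M + M') (N + N')" if "realised M N" "realised M' N'" for M M' N N'
  proof -
    obtain \<alpha> where "row_preserving \<alpha>" "row_partition \<alpha> = M" "row_partition (transpose_map \<alpha>) = N"
      using \<open>realised M N\<close> unfolding realised_def by blast
    moreover obtain \<beta>
      where "row_preserving \<beta>" "row_partition \<beta> = M'" "row_partition (transpose_map \<beta>) = N'"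
      using \<open>realised M' N'\<close> unfolding realised_def by blast
    ultimately show ?thesis
      unfolding realised_def
      by (intro exI[of _ "\<beta> \<circ>\<^sub>m \<alpha>"])
        (simp add: row_preserving_comp row_partition_comp transpose_map_comp
          transpose_map_row_preserving)
  qed
  have swap: "realised N M" if "realised M N" for M N
    using that transpose_map_row_preserving unfolding realised_def
    by (metis transpose_map_transpose_map)
  have single: "realised {#n#} {#}" for n
    unfolding realised_def
    using shift_first_rows_row_preserving row_partition_shift_first_rows
      row_partition_transpose_shift_first_rows by blast
  have empty: "realised {#} {#}"
  proof -
    have "row_partition (shift_first_rows 0) = {#}"
    proof (rule row_partition_eqI)
      show "row_shift (shift_first_rows 0) (Suc m) (tail_count {#} m)" for m
        unfolding row_shift_def using eventually_ge_at_top[of 1]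
        by eventually_elim (simp add: shift_first_rows_Some)
    qed
    then show ?thesis
      unfolding realised_def
      using shift_first_rows_row_preserving row_partition_transpose_shift_first_rows by blast
  qed
  have rows: "realised M {#}" for M
  proof (induction M)
    case (add n M)
    show ?case using sum[OF single[of n] add.IH] by simp
  qed (fact empty)
  have "realised M N"
    using sum[OF rows swap[OF rows], of M N] by simp
  then show ?thesis unfolding realised_def .
qed

section \<open>The quotient\<close>

text \<open>The homomorphism theorem for the kernel of a multiplicative surjection.\<close>

lemma quotient_monoid_iso:
  assumes closed: "\<And>a b. a \<in> carrier G \<Longrightarrow> b \<in> carrier G \<Longrightarrow> a \<otimes>\<^bsub>G\<^esub> b \<in> carrier G"
    and mult: "\<And>a b. a \<in> carrier G \<Longrightarrow> b \<in> carrier G \<Longrightarrow> \<phi> (a \<otimes>\<^bsub>G\<^esub> b) = \<phi> a \<otimes>\<^bsub>H\<^esub> \<phi> b"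
    and surj: "\<phi> ` carrier G = carrier H"
    and r: "r = {(a, b). a \<in> carrier G \<and> b \<in> carrier G \<and> \<phi> a = \<phi> b}"
  shows "quotient_monoid G r \<cong> H"
proof -
  define \<psi> where "\<psi> A = \<phi> (SOME a. a \<in> A)" for A
  have cls: "r `` {a} = {b \<in> carrier G. \<phi> b = \<phi> a}" if "a \<in> carrier G" for a
    using that r by auto
  have \<psi>: "\<psi> (r `` {a}) = \<phi> a" if "a \<in> carrier G" for a
    using someI[of "\<lambda>b. b \<in> r `` {a}" a] that by (auto simp: cls \<psi>_def)
  have carrier: "carrier (quotient_monoid G r) = (\<lambda>a. r `` {a}) ` carrier G"
    by (auto simp: quotient_monoid_def quotient_def)
  have mult_cls: "r `` {a} \<otimes>\<^bsub>quotient_monoid G r\<^esub> r `` {b} = r `` {a \<otimes>\<^bsub>G\<^esub> b}"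
    if a: "a \<in> carrier G" and b: "b \<in> carrier G" for a b
  proof -
    have "r `` {a' \<otimes>\<^bsub>G\<^esub> b'} = r `` {a \<otimes>\<^bsub>G\<^esub> b}" if "a' \<in> r `` {a}" "b' \<in> r `` {b}" for a' b'
      using that a b by (simp add: cls closed mult)
    then have "(\<Union>a'\<in>r `` {a}. \<Union>b'\<in>r `` {b}. r `` {a' \<otimes>\<^bsub>G\<^esub> b'}) =
        (\<Union>a'\<in>r `` {a}. \<Union>b'\<in>r `` {b}. r `` {a \<otimes>\<^bsub>G\<^esub> b})"
      by (intro SUP_cong refl)
    moreover have "r `` {a} \<noteq> {}" "r `` {b} \<noteq> {}"
      using a b by (auto simp: cls)
    ultimately show ?thesis
      unfolding quotient_monoid_def by (simp only: UN_constant if_False partial_object.simps monoid.simps)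
  qed
  have "\<psi> \<in> hom (quotient_monoid G r) H"
    unfolding hom_def carrier
    using surj by (auto simp: \<psi> mult_cls closed mult)
  moreover have "bij_betw \<psi> (carrier (quotient_monoid G r)) (carrier H)"
    unfolding bij_betw_def
  proof
    show "inj_on \<psi> (carrier (quotient_monoid G r))"
      unfolding carrier
    proof (rule inj_onI, elim imageE)
      fix A B a b
      assume "\<psi> A = \<psi> B" "A = r `` {a}" "a \<in> carrier G" "B = r `` {b}" "b \<in> carrier G"
      then show "A = B" using \<psi> cls by metis
    qed
    show "\<psi> ` carrier (quotient_monoid G r) = carrier H"
      unfolding carrier image_image using surj by (simp add: \<psi>)
  qed
  ultimately show ?thesis
    unfolding is_iso_def iso_def by blast
qed

theorem theorem16:
  fixes X :: "'a set"
  assumes "countable X" and "infinite X"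
  shows "quotient_monoid PO_inf_plus sigma_plus \<cong> free_comm_monoid X"
proof -
  \<comment> \<open>Even and odd positions in an enumeration of \<open>X\<close> carry the row and the column generators.\<close>
  define u where "u n = from_nat_into X (2 * n)" for n
  define v where "v n = from_nat_into X (2 * n + 1)" for n
  have bij: "bij_betw (from_nat_into X) UNIV X"
    by (rule bij_betw_from_nat_into[OF assms])
  then have inj: "inj (from_nat_into X)" by (rule bij_betw_imp_inj_on)
  have inj_u: "inj u" and inj_v: "inj v"
    unfolding u_def v_def by (intro injI; simp add: inj_eq[OF inj])+
  have disjoint: "u m \<noteq> v n" for m n
    using inj_eq[OF inj, of "2 * m" "2 * n + 1"] unfolding u_def v_def by presburger
  have cover: "X = range u \<union> range v"
  proof -
    have "from_nat_into X k \<in> range u \<union> range v" for k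
      by (cases "even k") (auto simp: u_def v_def elim!: evenE oddE)
    moreover have "range u \<union> range v \<subseteq> range (from_nat_into X)"
      by (auto simp: u_def v_def)
    ultimately have "range (from_nat_into X) = range u \<union> range v"
      by (intro equalityI image_subsetI)
    then show ?thesis
      by (simp only: bij_betw_imp_surj_on[OF bij])
  qed
  define join where "join M N = image_mset u M + image_mset v N" for M N
  have join_inject: "join M N = join M' N' \<longleftrightarrow> M = M' \<and> N = N'" for M N M' N'
  proof
    assume eq: "join M N = join M' N'"
    have filter: "{#x \<in># image_mset f M. x \<in> range f#} = image_mset f M"
      for f :: "nat \<Rightarrow> 'a" and M
      by (induction M) auto
    have "u n \<notin> range v" "v n \<notin> range u" for n
      using disjoint by (metis imageE)+
    then have filter': "{#x \<in># image_mset v M. x \<in> range u#} = {#}"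
      "{#x \<in># image_mset u M. x \<in> range v#} = {#}" for M
      by (induction M; simp)+
    have "{#x \<in># join M N. x \<in> range u#} = image_mset u M" for M N
      by (simp only: join_def filter_union_mset filter filter' add_0_right)
    moreover have "{#x \<in># join M N. x \<in> range v#} = image_mset v N" for M N
      by (simp only: join_def filter_union_mset filter filter' add_0_left)
    ultimately have "image_mset u M = image_mset u M'" "image_mset v N = image_mset v N'"
      using eq by metis+
    then show "M = M' \<and> N = N'"
      using inj_u inj_v by (metis injD multiset.inj_map)
  qed simp
  have join_surj: "\<exists>M N. join M N = A" if "set_mset A \<subseteq> X" for A
    using that
  proof (induction A)
    case empty
    then show ?case by (intro exI[of _ "{#}"]) (simp add: join_def)
  next
    case (add x A)
    then obtain M N where MN: "join M N = A" by auto
    from add.prems have "x \<in> range u \<union> range v" using cover by simp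
    then show ?case
    proof
      assume "x \<in> range u"
      then obtain n where "x = u n" by blast
      then have "join (add_mset n M) N = add_mset x A" using MN by (simp add: join_def)
      then show ?case by blast
    next
      assume "x \<in> range v"
      then obtain n where "x = v n" by blast
      then have "join M (add_mset n N) = add_mset x A" using MN by (simp add: join_def)
      then show ?case by blast
    qed
  qed
  define \<phi> where "\<phi> \<alpha> = join (row_partition \<alpha>) (row_partition (transpose_map \<alpha>))" for \<alpha>
  have mult: "\<alpha> \<otimes>\<^bsub>PO_inf_plus\<^esub> \<beta> = \<beta> \<circ>\<^sub>m \<alpha>" for \<alpha> \<beta>
    by (simp add: PO_inf_plus_def PO_inf_def)
  show ?thesis
  proof (rule quotient_monoid_iso[where \<phi> = \<phi>])
    fix \<alpha> \<beta> assume "\<alpha> \<in> carrier PO_inf_plus" "\<beta> \<in> carrier PO_inf_plus"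
    then have \<alpha>\<beta>: "row_preserving \<alpha>" "row_preserving \<beta>" by (simp_all add: carrier_PO_inf_plus)
    then show "\<alpha> \<otimes>\<^bsub>PO_inf_plus\<^esub> \<beta> \<in> carrier PO_inf_plus"
      by (simp add: mult carrier_PO_inf_plus row_preserving_comp)
    show "\<phi> (\<alpha> \<otimes>\<^bsub>PO_inf_plus\<^esub> \<beta>) = \<phi> \<alpha> \<otimes>\<^bsub>free_comm_monoid X\<^esub> \<phi> \<beta>"
      using \<alpha>\<beta> by (simp add: mult \<phi>_def free_comm_monoid_def join_def row_partition_comp
          transpose_map_comp transpose_map_row_preserving)
  next
    show "\<phi> ` carrier PO_inf_plus = carrier (free_comm_monoid X)"
    proof (rule equalityI; rule subsetI)
      fix A assume "A \<in> \<phi> ` carrier PO_inf_plus"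
      then show "A \<in> carrier (free_comm_monoid X)"
        using cover by (auto simp: \<phi>_def join_def free_comm_monoid_def)
    next
      fix A assume "A \<in> carrier (free_comm_monoid X)"
      then have "set_mset A \<subseteq> X" by (simp add: free_comm_monoid_def)
      then obtain M N where "join M N = A" using join_surj by blast
      then show "A \<in> \<phi> ` carrier PO_inf_plus"
        using row_partition_surj[of M N] by (auto simp: \<phi>_def carrier_PO_inf_plus)
    qed
  next
    have "(\<alpha>, \<beta>) \<in> sigma_plus \<longleftrightarrow>
        \<alpha> \<in> carrier PO_inf_plus \<and> \<beta> \<in> carrier PO_inf_plus \<and> \<phi> \<alpha> = \<phi> \<beta>" for \<alpha> \<beta>
      using finite_difference_iff[of \<alpha> \<beta>]
      by (auto simp: sigma_plus_def sigma_rel_iff carrier_PO_inf_plus \<phi>_def join_inject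
          row_preserving_def)
    then show "sigma_plus = {(\<alpha>, \<beta>). \<alpha> \<in> carrier PO_inf_plus \<and> \<beta> \<in> carrier PO_inf_plus \<and> \<phi> \<alpha> = \<phi> \<beta>}"
      by auto
  qed
qed

end
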